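(* Let $A,B$ be linear operators in a complex Hilbert space $H$ with $\operatorname{dom}(A)\subseteq\operatorname{dom}(B)$, and let $K$ be a linear operator in $H$. Assume that one of the following holds: (a) $W_e(A)=\emptyset$ and $K$ is $A$-form bounded with relative form bound $0$; (b) $W_e(B)=\emptyset$ and $K$ is $B$-form bounded with relative form bound $0$. Then $$w_e(A+K,B)=w_e(A,B),\qquad w_e(A,B+K)=w_e(A,B).$$
   Context: For a linear operator $S$ in $H$, $W_e(S)$ is the set of all $\mu\in\mathbb C$ for which there are $x_n\in\operatorname{dom}(S)$ with $\|x_n\|=1$, $x_n\to0$ weakly and $\langle Sx_n,x_n\rangle\to\mu$. For linear operators $A,B$ with $\operatorname{dom}(A)\subseteq\operatorname{dom}(B)$, $w_e(A,B)$ is the set of all limits $\lim_{n\to\infty}\frac{\langle Ax_n,x_n\rangle}{\langle Bx_n,x_n\rangle}$ with $x_n\in\operatorname{dom}(A)$, $\langle Bx_n,x_n\rangle\neq0$, $\|x_n\|=1$, $x_n\to0$ weakly. An operator $S$ is $T$-form bounded if $\operatorname{dom}(T)\subseteq\operatorname{dom}(S)$ and there are $\alpha',\beta'\ge0$ with $|\langle Sx,x\rangle|\le\alpha'\|x\|^2+\beta'|\langle Tx,x\rangle|$ for all $x\in\operatorname{dom}(T)$; the infimum of all $\beta'\ge0$ for which such an $\alpha'$ exists is the relative form bound. Sums of operators are defined on the intersection of domains. *)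

theory Defs
  imports "HOL-Analysis.Analysis"
begin

section \<open>Complex Hilbert spaces\<close>

class complex_vector = real_vector +
  fixes scaleC :: "complex \<Rightarrow> 'a \<Rightarrow> 'a"  (infixr "*\<^sub>C" 75)
  assumes scaleC_add_right: "c *\<^sub>C (x + y) = c *\<^sub>C x + c *\<^sub>C y"
    and scaleC_add_left: "(c + d) *\<^sub>C x = c *\<^sub>C x + d *\<^sub>C x"
    and scaleC_scaleC: "c *\<^sub>C (d *\<^sub>C x) = (c * d) *\<^sub>C x"
    and scaleC_of_real: "complex_of_real r *\<^sub>C x = r *\<^sub>R x"

global_interpretation complex_vector:
  vector_space "scaleC :: complex \<Rightarrow> 'a \<Rightarrow> 'a :: complex_vector"
proof
  show "1 *\<^sub>C x = x" for x :: 'a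
    using scaleC_of_real[of 1 x] by simp
qed (simp_all add: scaleC_add_right scaleC_add_left scaleC_scaleC)

text \<open>The inner product is linear in its first argument.\<close>

class complex_inner = complex_vector + real_normed_vector +
  fixes cinner :: "'a \<Rightarrow> 'a \<Rightarrow> complex"
  assumes cinner_commute: "cinner x y = cnj (cinner y x)"
    and cinner_add_left: "cinner (x + y) z = cinner x z + cinner y z"
    and cinner_scaleC_left: "cinner (c *\<^sub>C x) y = c * cinner x y"
    and cinner_ge_zero: "0 \<le> Re (cinner x x)"
    and cinner_eq_zero_iff: "cinner x x = 0 \<longleftrightarrow> x = 0"
    and norm_eq_sqrt_cinner: "norm x = sqrt (Re (cinner x x))"

class complex_hilbert_space = complex_inner + complete_space

definition weakly_tendsto :: "(nat \<Rightarrow> 'a :: complex_inner) \<Rightarrow> 'a \<Rightarrow> bool" where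
  "weakly_tendsto x l \<longleftrightarrow> (\<forall>y. (\<lambda>n. cinner (x n) y) \<longlonglongrightarrow> cinner l y)"

section \<open>Linear operators\<close>

text \<open>
  Operators need not be bounded, closed or densely defined. The values of \<open>op_app\<close> outside
  \<open>op_dom\<close> carry no meaning.
\<close>

record 'a operator =
  op_dom :: "'a set"
  op_app :: "'a \<Rightarrow> 'a"

definition linear_operator :: "'a :: complex_vector operator \<Rightarrow> bool" where
  "linear_operator T \<longleftrightarrow>
     complex_vector.subspace (op_dom T) \<and>
     (\<forall>x\<in>op_dom T. \<forall>y\<in>op_dom T. op_app T (x + y) = op_app T x + op_app T y) \<and>
     (\<forall>c. \<forall>x\<in>op_dom T. op_app T (c *\<^sub>C x) = c *\<^sub>C op_app T x)"

definition op_add :: "'a :: complex_vector operator \<Rightarrow> 'a operator \<Rightarrow> 'a operator"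
    (infixl "+\<^sub>o" 65) where
  "S +\<^sub>o T = \<lparr>op_dom = op_dom S \<inter> op_dom T, op_app = (\<lambda>x. op_app S x + op_app T x)\<rparr>"

section \<open>Essential numerical ranges\<close>

definition W_e :: "'a :: complex_hilbert_space operator \<Rightarrow> complex set" where
  "W_e S = {\<mu>. \<exists>x. (\<forall>n. x n \<in> op_dom S \<and> norm (x n) = 1) \<and> weakly_tendsto x 0 \<and>
                    (\<lambda>n. cinner (op_app S (x n)) (x n)) \<longlonglongrightarrow> \<mu>}"

text \<open>This is meaningful only if \<open>op_dom A \<subseteq> op_dom B\<close>.\<close>

definition w_e :: "'a :: complex_hilbert_space operator \<Rightarrow> 'a operator \<Rightarrow> complex set" where
  "w_e A B = {\<mu>. \<exists>x. (\<forall>n. x n \<in> op_dom A \<and> cinner (op_app B (x n)) (x n) \<noteq> 0 \<and> norm (x n) = 1) \<and>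
                      weakly_tendsto x 0 \<and>
                      (\<lambda>n. cinner (op_app A (x n)) (x n) / cinner (op_app B (x n)) (x n)) \<longlonglongrightarrow> \<mu>}"

section \<open>Relative form boundedness\<close>

definition form_bound_coeffs ::
    "'a :: complex_hilbert_space operator \<Rightarrow> 'a operator \<Rightarrow> real set" where
  "form_bound_coeffs S T =
     {\<beta>. \<beta> \<ge> 0 \<and> (\<exists>\<alpha>\<ge>0. \<forall>x\<in>op_dom T.
        cmod (cinner (op_app S x) x) \<le> \<alpha> * (norm x)\<^sup>2 + \<beta> * cmod (cinner (op_app T x) x))}"

definition form_bounded ::
    "'a :: complex_hilbert_space operator \<Rightarrow> 'a operator \<Rightarrow> bool" where
  "form_bounded S T \<longleftrightarrow> op_dom T \<subseteq> op_dom S \<and> form_bound_coeffs S T \<noteq> {}"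

text \<open>As an infimum of reals, this is meaningful only if \<open>form_bounded S T\<close>.\<close>

definition relative_form_bound ::
    "'a :: complex_hilbert_space operator \<Rightarrow> 'a operator \<Rightarrow> real" where
  "relative_form_bound S T = Inf (form_bound_coeffs S T)"

end

theory Submission
  imports Defs
begin

text \<open>
  Write \<open>a\<^sub>n\<close>, \<open>b\<^sub>n\<close>, \<open>k\<^sub>n\<close> for the forms of \<open>A\<close>, \<open>B\<close>, \<open>K\<close> along a weakly null sequence of unit
  vectors. If the essential numerical range of \<open>A\<close> (or \<open>B\<close>) is empty, then \<open>\<bar>a\<^sub>n\<bar> \<rightarrow> \<infinity>\<close> (or
  \<open>\<bar>b\<^sub>n\<bar> \<rightarrow> \<infinity>\<close>), so relative form bound \<open>0\<close> gives \<open>k\<^sub>n = o(a\<^sub>n)\<close> (or \<open>k\<^sub>n = o(b\<^sub>n)\<close>). As soon as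
  one of the quotients in question converges, \<open>k\<^sub>n\<close> is therefore negligible against its
  denominator in both cases, and adding \<open>K\<close> to the numerator or denominator changes no limit.
\<close>

definition op_form :: "'a :: complex_inner operator \<Rightarrow> 'a \<Rightarrow> complex" where
  "op_form S x = cinner (op_app S x) x"

lemma op_form_op_add: "op_form (S +\<^sub>o T) x = op_form S x + op_form T x"
  by (simp add: op_form_def op_add_def cinner_add_left)

text \<open>The common condition on sequences in \<open>W_e\<close> and \<open>w_e\<close>. The
  domain is a parameter so that one sequence can serve for several operators.\<close>

definition weakly_null_unit_seq :: "'a :: complex_inner set \<Rightarrow> (nat \<Rightarrow> 'a) \<Rightarrow> bool" where
  "weakly_null_unit_seq D x \<longleftrightarrow> (\<forall>n. x n \<in> D \<and> norm (x n) = 1) \<and> weakly_tendsto x 0"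

lemma weakly_null_unit_seq_mono:
  "weakly_null_unit_seq D x \<Longrightarrow> D \<subseteq> E \<Longrightarrow> weakly_null_unit_seq E x"
  by (auto simp: weakly_null_unit_seq_def)

lemma weakly_null_unit_seq_subseq:
  assumes "weakly_null_unit_seq D x" "strict_mono r"
  shows "weakly_null_unit_seq D (x \<circ> r)"
  using assms LIMSEQ_subseq_LIMSEQ[of _ _ r]
  by (fastforce simp: weakly_null_unit_seq_def weakly_tendsto_def o_def)

lemma W_e_iff:
  "\<mu> \<in> W_e S \<longleftrightarrow>
     (\<exists>x. weakly_null_unit_seq (op_dom S) x \<and> (\<lambda>n. op_form S (x n)) \<longlonglongrightarrow> \<mu>)"
  by (auto simp: W_e_def weakly_null_unit_seq_def op_form_def)

lemma w_eE:
  assumes "\<mu> \<in> w_e A B"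
  obtains x where "weakly_null_unit_seq (op_dom A) x" "\<And>n. op_form B (x n) \<noteq> 0"
    "(\<lambda>n. op_form A (x n) / op_form B (x n)) \<longlonglongrightarrow> \<mu>"
  using assms by (auto simp: w_e_def weakly_null_unit_seq_def op_form_def)

text \<open>Changing the denominator by \<open>K\<close> keeps it nonzero only for large
  \<open>n\<close>, whereas \<open>w_e\<close> asks for this at every index. Passing to a tail of
  the sequence closes the gap.\<close>

lemma w_eI_eventually:
  assumes x: "weakly_null_unit_seq (op_dom A) x"
    and nz: "\<forall>\<^sub>F n in sequentially. op_form B (x n) \<noteq> 0"
    and lim: "(\<lambda>n. op_form A (x n) / op_form B (x n)) \<longlonglongrightarrow> \<mu>"
  shows "\<mu> \<in> w_e A B"
proof -
  obtain N where N: "\<And>n. n \<ge> N \<Longrightarrow> op_form B (x n) \<noteq> 0"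
    using nz by (auto simp: eventually_sequentially)
  have mono: "strict_mono (\<lambda>n. n + N)"
    by (simp add: strict_mono_def)
  have "weakly_null_unit_seq (op_dom A) (\<lambda>n. x (n + N))"
    using weakly_null_unit_seq_subseq[OF x mono] by (simp add: o_def)
  moreover have "\<And>n. op_form B (x (n + N)) \<noteq> 0"
    by (simp add: N)
  moreover have "(\<lambda>n. op_form A (x (n + N)) / op_form B (x (n + N))) \<longlonglongrightarrow> \<mu>"
    using LIMSEQ_ignore_initial_segment[OF lim, of N] .
  ultimately show ?thesis
    unfolding w_e_def weakly_null_unit_seq_def op_form_def
    by (intro CollectI exI[of _ "\<lambda>n. x (n + N)"]) blast
qed

text \<open>Otherwise the forms stay bounded along some subsequence, and Bolzano-Weierstrass yields
  a limit point. Subsequences remain weakly null, so this point would lie in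
  \<open>W_e S\<close>.\<close>

lemma op_form_at_infinity:
  assumes "W_e S = {}" and x: "weakly_null_unit_seq (op_dom S) x"
  shows "filterlim (\<lambda>n. op_form S (x n)) at_infinity sequentially"
proof (rule ccontr)
  assume "\<not> ?thesis"
  then obtain c where c: "\<not> (\<forall>\<^sub>F n in sequentially. c \<le> norm (op_form S (x n)))"
    unfolding filterlim_at_infinity[OF order_refl] by blast
  define M where "M = {n. norm (op_form S (x n)) < c}"
  have "infinite M"
    using c unfolding M_def
    by (auto simp: cofinite_eq_sequentially[symmetric] eventually_cofinite not_le)
  then obtain r :: "nat \<Rightarrow> nat" where r: "strict_mono r" "\<And>n. r n \<in> M"
    using infinite_enumerate by blast
  have "bounded (range (\<lambda>n. op_form S (x (r n))))"
    using r(2) unfolding bounded_iff M_def by (auto intro!: exI[of _ c] less_imp_le)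
  then obtain l s where s: "strict_mono s" "((\<lambda>n. op_form S (x (r n))) \<circ> s) \<longlonglongrightarrow> l"
    using bounded_imp_convergent_subsequence by blast
  have "weakly_null_unit_seq (op_dom S) (x \<circ> (r \<circ> s))"
    by (intro weakly_null_unit_seq_subseq x strict_mono_o r s)
  then have "l \<in> W_e S"
    unfolding W_e_iff using s(2) by (auto simp: o_def)
  with assms(1) show False by simp
qed

lemma op_form_quotient_null:
  assumes W: "W_e T = {}" and bdd: "form_bounded K T" and rel: "relative_form_bound K T = 0"
    and x: "weakly_null_unit_seq (op_dom T) x"
  shows "(\<lambda>n. op_form K (x n) / op_form T (x n)) \<longlonglongrightarrow> 0"
proof (rule tendstoI)
  fix e :: real assume e: "e > 0"
  \<comment> \<open>The infimum need not be attained, so a coefficient below \<open>e / 2\<close> is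
    taken; the other half of \<open>e\<close> is kept for the constant \<alpha> that comes with
    it.\<close>
  have "Inf (form_bound_coeffs K T) < e / 2"
    using rel e by (simp add: relative_form_bound_def)
  then obtain \<beta> where \<beta>: "\<beta> \<in> form_bound_coeffs K T" "\<beta> < e / 2"
    using cInf_lessD bdd unfolding form_bounded_def by blast
  then obtain \<alpha> where \<alpha>: "\<alpha> \<ge> 0" "\<And>y. y \<in> op_dom T \<Longrightarrow>
      cmod (op_form K y) \<le> \<alpha> * (norm y)\<^sup>2 + \<beta> * cmod (op_form T y)"
    unfolding form_bound_coeffs_def op_form_def by blast
  \<comment> \<open>Beyond this threshold \<alpha> is less than \<open>e / 2\<close> times the
    modulus of the form of \<open>T\<close>. The summand \<open>1\<close> makes this strict and
    keeps the form away from zero.\<close>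
  have "2 * \<alpha> / e + 1 > 0"
    using \<alpha>(1) e by (simp add: add_nonneg_pos)
  then have "\<forall>\<^sub>F n in sequentially. norm (op_form T (x n)) \<ge> 2 * \<alpha> / e + 1"
    using op_form_at_infinity[OF W x] by (simp add: filterlim_at_infinity[of 0])
  then show "\<forall>\<^sub>F n in sequentially. dist (op_form K (x n) / op_form T (x n)) 0 < e"
  proof eventually_elim
    case (elim n)
    let ?t = "cmod (op_form T (x n))"
    have t: "?t > 0"
      using elim \<alpha>(1) e by (smt (verit) divide_nonneg_pos)
    have "\<alpha> < e / 2 * ?t"
      using elim e by (simp add: field_simps)
    moreover have "\<beta> * ?t \<le> e / 2 * ?t"
      using \<beta>(2) t by (intro mult_right_mono) auto
    moreover have "cmod (op_form K (x n)) \<le> \<alpha> + \<beta> * ?t"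
      using \<alpha>(2)[of "x n"] x by (auto simp: weakly_null_unit_seq_def)
    ultimately have "cmod (op_form K (x n)) < e * ?t"
      by (simp add: field_simps)
    then show ?case
      using t by (simp add: norm_divide field_simps)
  qed
qed

text \<open>Factor \<open>d + k = d * (1 + k / d)\<close>, where the second factor tends to
  1.\<close>

lemma null_quotient_add:
  fixes d k :: "nat \<Rightarrow> complex"
  assumes nz: "\<forall>\<^sub>F n in sequentially. d n \<noteq> 0" and lim: "(\<lambda>n. k n / d n) \<longlonglongrightarrow> 0"
  shows "\<forall>\<^sub>F n in sequentially. d n + k n \<noteq> 0"
    and "(\<lambda>n. c n / d n) \<longlonglongrightarrow> \<mu> \<Longrightarrow> (\<lambda>n. c n / (d n + k n)) \<longlonglongrightarrow> \<mu>"
proof -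
  have one: "(\<lambda>n. 1 + k n / d n) \<longlonglongrightarrow> 1"
    using tendsto_add[OF tendsto_const lim, of 1] by simp
  have "\<forall>\<^sub>F n in sequentially. 1 + k n / d n \<noteq> 0"
    using tendsto_imp_eventually_ne[OF one] by simp
  with nz show "\<forall>\<^sub>F n in sequentially. d n + k n \<noteq> 0"
    by eventually_elim (simp add: field_simps)
  assume "(\<lambda>n. c n / d n) \<longlonglongrightarrow> \<mu>"
  then have "(\<lambda>n. c n / d n / (1 + k n / d n)) \<longlonglongrightarrow> \<mu>"
    using tendsto_divide[OF _ one] by fastforce
  then show "(\<lambda>n. c n / (d n + k n)) \<longlonglongrightarrow> \<mu>"
    by (rule Lim_transform_eventually)
      (use nz in eventually_elim, simp add: field_simps)
qed

text \<open>Since \<open>k / d = (k / a) * (a / d)\<close> and the last factor converges, being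
  negligible against a numerator passes to being negligible against the denominator.\<close>

lemma null_quotient_trans:
  fixes a d k :: "nat \<Rightarrow> complex"
  assumes nz: "\<forall>\<^sub>F n in sequentially. a n \<noteq> 0"
    and "(\<lambda>n. k n / a n) \<longlonglongrightarrow> 0" "(\<lambda>n. a n / d n) \<longlonglongrightarrow> \<mu>"
  shows "(\<lambda>n. k n / d n) \<longlonglongrightarrow> 0"
proof -
  have "(\<lambda>n. k n / a n * (a n / d n)) \<longlonglongrightarrow> 0"
    using tendsto_mult[OF assms(2,3)] by simp
  then show ?thesis
    by (rule Lim_transform_eventually) (use nz in eventually_elim, simp)
qed

theorem theorem2p24:
  fixes A B K :: "'a :: complex_hilbert_space operator"
  assumes "linear_operator A" and "linear_operator B" and "linear_operator K"
    and "op_dom A \<subseteq> op_dom B"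
    and "(W_e A = {} \<and> form_bounded K A \<and> relative_form_bound K A = 0) \<or>
         (W_e B = {} \<and> form_bounded K B \<and> relative_form_bound K B = 0)"
  shows "w_e (A +\<^sub>o K) B = w_e A B \<and> w_e A (B +\<^sub>o K) = w_e A B"
proof -
  \<comment> \<open>If \<open>K\<close> is form bounded relative to \<open>B\<close>, the inclusion
    of \<open>op_dom A\<close> in \<open>op_dom K\<close> goes through
    \<open>op_dom B\<close>.\<close>
  have dom: "op_dom (A +\<^sub>o K) = op_dom A"
    using assms(4,5) by (auto simp: op_add_def form_bounded_def)
  \<comment> \<open>Both alternatives of the hypothesis enter below only through this dichotomy for
    sequences in \<open>op_dom A\<close>.\<close>
  have negligible: "((\<forall>\<^sub>F n in sequentially. op_form A (x n) \<noteq> 0) \<and>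
        (\<lambda>n. op_form K (x n) / op_form A (x n)) \<longlonglongrightarrow> 0) \<or>
      ((\<forall>\<^sub>F n in sequentially. op_form B (x n) \<noteq> 0) \<and>
        (\<lambda>n. op_form K (x n) / op_form B (x n)) \<longlonglongrightarrow> 0)"
    if x: "weakly_null_unit_seq (op_dom A) x" for x
  proof -
    have nz: "(\<forall>\<^sub>F n in sequentially. op_form T (x n) \<noteq> 0) \<and>
        (\<lambda>n. op_form K (x n) / op_form T (x n)) \<longlonglongrightarrow> 0"
      if "W_e T = {}" "form_bounded K T" "relative_form_bound K T = 0" "op_dom A \<subseteq> op_dom T" for T
      using op_form_at_infinity[of T x] op_form_quotient_null[of T K x] that
        weakly_null_unit_seq_mono[OF x] filterlim_at_infinity_imp_eventually_ne by blast
    show ?thesis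
      using assms(5) nz[of A] nz[of B] assms(4) by blast
  qed
  have sub_num: "w_e A B \<subseteq> w_e (A +\<^sub>o K) B" and sub_den: "w_e A B \<subseteq> w_e A (B +\<^sub>o K)"
  proof -
    have "\<mu> \<in> w_e (A +\<^sub>o K) B \<and> \<mu> \<in> w_e A (B +\<^sub>o K)" if "\<mu> \<in> w_e A B" for \<mu>
      using that
    proof (rule w_eE)
      fix x assume x: "weakly_null_unit_seq (op_dom A) x" and nz: "\<And>n. op_form B (x n) \<noteq> 0"
        and lim: "(\<lambda>n. op_form A (x n) / op_form B (x n)) \<longlonglongrightarrow> \<mu>"
      from negligible[OF x]
      \<comment> \<open>If \<open>K\<close> is negligible against \<open>A\<close>, convergence of
        the quotient transfers this to \<open>B\<close>; the other case is immediate.\<close>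
      have null: "(\<lambda>n. op_form K (x n) / op_form B (x n)) \<longlonglongrightarrow> 0"
        by (elim disjE conjE) (rule null_quotient_trans[OF _ _ lim]; assumption)
      have "\<mu> \<in> w_e (A +\<^sub>o K) B"
        using x nz tendsto_add[OF lim null]
        by (intro w_eI_eventually[of _ x]) (simp_all add: dom op_form_op_add add_divide_distrib)
      moreover have "\<mu> \<in> w_e A (B +\<^sub>o K)"
        using null_quotient_add[OF _ null] nz lim x
        by (intro w_eI_eventually[of _ x]) (simp_all add: op_form_op_add)
      ultimately show ?thesis ..
    qed
    then show "w_e A B \<subseteq> w_e (A +\<^sub>o K) B" "w_e A B \<subseteq> w_e A (B +\<^sub>o K)"
      by blast+
  qed
  have sup_num: "w_e (A +\<^sub>o K) B \<subseteq> w_e A B"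
  proof
    fix \<mu> assume "\<mu> \<in> w_e (A +\<^sub>o K) B"
    then show "\<mu> \<in> w_e A B"
    proof (rule w_eE)
      fix x assume "weakly_null_unit_seq (op_dom (A +\<^sub>o K)) x"
        and nz: "\<And>n. op_form B (x n) \<noteq> 0"
        and "(\<lambda>n. op_form (A +\<^sub>o K) (x n) / op_form B (x n)) \<longlonglongrightarrow> \<mu>"
      then have x: "weakly_null_unit_seq (op_dom A) x"
        and lim: "(\<lambda>n. (op_form A (x n) + op_form K (x n)) / op_form B (x n)) \<longlonglongrightarrow> \<mu>"
        by (simp_all add: dom op_form_op_add)
      from negligible[OF x]
      have null: "(\<lambda>n. op_form K (x n) / op_form B (x n)) \<longlonglongrightarrow> 0"
      proof (elim disjE conjE)
        assume a: "\<forall>\<^sub>F n in sequentially. op_form A (x n) \<noteq> 0"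
          "(\<lambda>n. op_form K (x n) / op_form A (x n)) \<longlonglongrightarrow> 0"
        \<comment> \<open>Here only the quotient with numerator \<open>A + K\<close> is known to
          converge. So the comparison runs through \<open>a\<^sub>n + k\<^sub>n\<close>, against
          which \<open>k\<^sub>n\<close> is still negligible.\<close>
        show ?thesis
          by (rule null_quotient_trans[OF null_quotient_add(1)[OF a] null_quotient_add(2)[OF a a(2)] lim])
      qed
      show ?thesis
        using x nz tendsto_diff[OF lim null]
        by (intro w_eI_eventually[of _ x]) (simp_all add: diff_divide_distrib[symmetric])
    qed
  qed
  have sup_den: "w_e A (B +\<^sub>o K) \<subseteq> w_e A B"
  proof
    fix \<mu> assume "\<mu> \<in> w_e A (B +\<^sub>o K)"
    then show "\<mu> \<in> w_e A B"
    proof (rule w_eE)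
      fix x assume x: "weakly_null_unit_seq (op_dom A) x"
        and "\<And>n. op_form (B +\<^sub>o K) (x n) \<noteq> 0"
        and "(\<lambda>n. op_form A (x n) / op_form (B +\<^sub>o K) (x n)) \<longlonglongrightarrow> \<mu>"
      then have nz: "\<forall>\<^sub>F n in sequentially. op_form B (x n) + op_form K (x n) \<noteq> 0"
        and lim: "(\<lambda>n. op_form A (x n) / (op_form B (x n) + op_form K (x n))) \<longlonglongrightarrow> \<mu>"
        by (simp_all add: op_form_op_add)
      from negligible[OF x]
      \<comment> \<open>Against \<open>A\<close>, the limit \<open>lim\<close> carries negligibility
        over to the denominator \<open>b\<^sub>n + k\<^sub>n\<close>; against \<open>B\<close>, it
        survives the replacement of \<open>b\<^sub>n\<close> by
        \<open>b\<^sub>n + k\<^sub>n\<close>.\<close>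
      have null: "(\<lambda>n. op_form K (x n) / (op_form B (x n) + op_form K (x n))) \<longlonglongrightarrow> 0"
        by (elim disjE conjE) (rule null_quotient_trans[OF _ _ lim] null_quotient_add(2); assumption)+
      \<comment> \<open>The form of \<open>B\<close> is recovered by perturbing
        \<open>b\<^sub>n + k\<^sub>n\<close> with the negligible term \<open>- k\<^sub>n\<close>.
        This also shows that \<open>b\<^sub>n\<close> is eventually nonzero.\<close>
      then have "(\<lambda>n. - op_form K (x n) / (op_form B (x n) + op_form K (x n))) \<longlonglongrightarrow> 0"
        using tendsto_minus[OF null] by simp
      from null_quotient_add[OF nz this] lim x show ?thesis
        by (intro w_eI_eventually[of _ x]) simp_all
    qed
  qed
  show ?thesis
    using sub_num sub_den sup_num sup_den by blast
qed

end
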